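(* Let $G$ be a graph on $n$ vertices with maximum degree $\Delta = \Delta_G$. For all $t \in \mathbb{N}$ with $t \leq \Delta$, we have \[ \beta(G) \geq \sqrt{t} - \frac{\Delta }{n}\left(\sqrt{t} + 1\right)^2. \]
   Context: $\mathbb{N}$ is the set of positive integers. Graphs are finite and simple. For a graph $G$ with adjacency matrix $A$, $\beta(G) = \max \frac{x^{\intercal} A x}{x^{\intercal} x}$, the maximum being over all nonzero $x \in \mathbb{R}^{V(G)}$ orthogonal to the all ones vector. *)

theory Defs
  imports "HOL-Analysis.Analysis"
begin

text \<open>
  The vertex set of a finite graph is a finite type \<open>'v\<close>, so that \<open>real ^ 'v\<close> is the space of
  real vectors indexed by the vertices; a graph is given by its adjacency relation.
\<close>

definition simple_graph :: "('v::finite \<Rightarrow> 'v \<Rightarrow> bool) \<Rightarrow> bool" where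
  "simple_graph G \<longleftrightarrow> symp G \<and> irreflp G"

definition vertex_degree :: "('v::finite \<Rightarrow> 'v \<Rightarrow> bool) \<Rightarrow> 'v \<Rightarrow> nat" where
  "vertex_degree G u = card {v. G u v}"

definition max_degree :: "('v::finite \<Rightarrow> 'v \<Rightarrow> bool) \<Rightarrow> nat" where
  "max_degree G = Max (range (vertex_degree G))"

definition adjacency_matrix :: "('v::finite \<Rightarrow> 'v \<Rightarrow> bool) \<Rightarrow> real ^ 'v ^ 'v" where
  "adjacency_matrix G = (\<chi> u v. if G u v then 1 else 0)"

definition rayleigh_quotient :: "real ^ 'v ^ 'v \<Rightarrow> real ^ 'v::finite \<Rightarrow> real" where
  "rayleigh_quotient A x = (x \<bullet> (A *v x)) / (x \<bullet> x)"

text \<open>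
  In \<open>x \<bullet> 1\<close> the constant \<open>1\<close> is the all ones vector. The maximum is unspecified for the graph
  on one vertex, where no vector is admissible; by \<open>beta_is_maximum\<close> below it is attained for
  every other graph.
\<close>

definition beta :: "('v::finite \<Rightarrow> 'v \<Rightarrow> bool) \<Rightarrow> real" where
  "beta G = (GREATEST b. \<exists>x. x \<noteq> 0 \<and> x \<bullet> 1 = 0 \<and> b = rayleigh_quotient (adjacency_matrix G) x)"

lemma rayleigh_quotient_scaleR:
  assumes "c \<noteq> 0"
  shows "rayleigh_quotient A (c *\<^sub>R x) = rayleigh_quotient A x"
  using assms by (simp add: rayleigh_quotient_def matrix_vector_mult_scaleR)

lemma rayleigh_quotient_attains_max:
  fixes A :: "real ^ 'v ^ 'v::finite"
  assumes "CARD('v) \<ge> 2"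
  obtains x where "x \<noteq> 0" "x \<bullet> 1 = 0"
    "\<And>y. y \<noteq> 0 \<Longrightarrow> y \<bullet> 1 = 0 \<Longrightarrow> rayleigh_quotient A y \<le> rayleigh_quotient A x"
proof -
  define S where "S = {x :: real ^ 'v. x \<bullet> 1 = 0} \<inter> sphere 0 1"
  have normalize: "(1 / norm y) *\<^sub>R y \<in> S" if "y \<noteq> 0" "y \<bullet> 1 = 0" for y
    using that by (simp add: S_def)
  have "closed {x :: real ^ 'v. x \<bullet> 1 = 0}"
    by (intro closed_Collect_eq continuous_intros)
  then have "compact S"
    unfolding S_def by (intro closed_Int_compact) simp_all
  moreover have "S \<noteq> {}"
  proof -
    obtain u v :: 'v where "u \<noteq> v"
      using ex_card[OF assms] by (metis (full_types) card_2_iff)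
    then have "axis u 1 - axis v 1 \<noteq> (0 :: real ^ 'v)"
      by (simp add: axis_eq_axis)
    moreover have "(axis u 1 - axis v 1) \<bullet> (1 :: real ^ 'v) = 0"
      by (simp add: inner_diff_left inner_axis')
    ultimately show ?thesis
      using normalize by blast
  qed
  moreover have "continuous_on S (rayleigh_quotient A)"
    unfolding rayleigh_quotient_def
    by (rule continuous_on_divide, rule continuous_on_inner[OF continuous_on_id],
        rule matrix_vector_mult_linear_continuous_on, intro continuous_intros)
      (auto simp: S_def)
  ultimately obtain x where x: "x \<in> S" "\<And>y. y \<in> S \<Longrightarrow> rayleigh_quotient A y \<le> rayleigh_quotient A x"
    using continuous_attains_sup[of S "rayleigh_quotient A"] by blast
  show ?thesis
  proof (rule that)
    show "x \<noteq> 0" "x \<bullet> 1 = 0"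
      using x(1) by (auto simp: S_def)
    show "rayleigh_quotient A y \<le> rayleigh_quotient A x" if "y \<noteq> 0" "y \<bullet> 1 = 0" for y
      using x(2)[OF normalize[OF that]] that by (simp add: rayleigh_quotient_scaleR)
  qed
qed

lemma beta_is_maximum:
  fixes G :: "'v::finite \<Rightarrow> 'v \<Rightarrow> bool"
  assumes "CARD('v) \<ge> 2"
  shows "\<exists>x. x \<noteq> 0 \<and> x \<bullet> 1 = 0 \<and> beta G = rayleigh_quotient (adjacency_matrix G) x"
    and "\<And>y. y \<noteq> 0 \<Longrightarrow> y \<bullet> 1 = 0 \<Longrightarrow> rayleigh_quotient (adjacency_matrix G) y \<le> beta G"
proof -
  obtain x where x: "x \<noteq> 0" "x \<bullet> 1 = 0"
    "\<And>y. y \<noteq> 0 \<Longrightarrow> y \<bullet> 1 = 0 \<Longrightarrow>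
      rayleigh_quotient (adjacency_matrix G) y \<le> rayleigh_quotient (adjacency_matrix G) x"
    using rayleigh_quotient_attains_max[OF assms] by blast
  have eq: "beta G = rayleigh_quotient (adjacency_matrix G) x"
    unfolding beta_def by (rule Greatest_equality) (use x in auto)
  show "\<exists>x. x \<noteq> 0 \<and> x \<bullet> 1 = 0 \<and> beta G = rayleigh_quotient (adjacency_matrix G) x"
    using x(1,2) eq by blast
  show "\<And>y. y \<noteq> 0 \<Longrightarrow> y \<bullet> 1 = 0 \<Longrightarrow> rayleigh_quotient (adjacency_matrix G) y \<le> beta G"
    using x(3) eq by simp
qed

end

theory Submission
  imports Defs
begin

text \<open>
  Let \<open>u\<close> have degree \<open>\<Delta>\<close> and let \<open>x\<close> be \<open>\<surd>t\<close> at \<open>u\<close>, \<open>1\<close> on \<open>t\<close> neighbours of \<open>u\<close> and \<open>0\<close>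
  elsewhere. Then \<open>A x \<ge> \<surd>t x\<close> pointwise, so \<open>x\<^sup>T A x \<ge> 2 t \<surd>t\<close>. Projecting \<open>x\<close> to the orthogonal
  complement of the all ones vector lowers the quadratic form by at most \<open>2 \<Delta> (x \<bullet> 1)\<^sup>2 / n\<close> and
  does not increase the norm, which gives the bound whenever its right hand side is positive.
  Otherwise, the difference of two basis vectors is a good enough test vector: it shows \<open>\<beta> \<ge> 0\<close>
  unless the graph is complete, and \<open>\<beta> \<ge> -1\<close> in that case, where the right hand side is at
  most \<open>-1\<close>.
\<close>

lemma adjacency_matrix_mult_nth:
  "(adjacency_matrix G *v x) $ u = (\<Sum>v | G u v. x $ v)"
  by (simp add: adjacency_matrix_def matrix_vector_mult_def if_distribR if_distrib
      flip: sum.inter_filter cong: if_cong)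

lemma adjacency_matrix_mult_one_nth:
  "(adjacency_matrix G *v 1) $ u = real (vertex_degree G u)"
  by (simp add: adjacency_matrix_mult_nth vertex_degree_def)

lemma vertex_degree_le_max_degree: "vertex_degree G u \<le> max_degree G"
  by (simp add: max_degree_def)

lemma max_degree_attained:
  obtains u where "vertex_degree G u = max_degree G"
proof -
  have "max_degree G \<in> range (vertex_degree G)"
    unfolding max_degree_def by (intro Max_in) auto
  with that show ?thesis by auto
qed

lemma inner_adjacency_matrix_commute:
  assumes "simple_graph G"
  shows "x \<bullet> (adjacency_matrix G *v y) = y \<bullet> (adjacency_matrix G *v x)"
proof -
  have "transpose (adjacency_matrix G) = adjacency_matrix G"
    using assms by (auto simp: transpose_def adjacency_matrix_def simple_graph_def vec_eq_iff
        dest: sympD)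
  then have "x v* adjacency_matrix G = adjacency_matrix G *v x"
    by (metis transpose_matrix_vector)
  then show ?thesis
    by (metis dot_lmul_matrix inner_commute)
qed

lemma inner_adjacency_matrix_one_le:
  assumes "\<And>w. x $ w \<ge> 0"
  shows "x \<bullet> (adjacency_matrix G *v 1) \<le> real (max_degree G) * (x \<bullet> 1)"
  by (auto simp: inner_vec_def adjacency_matrix_mult_one_nth sum_distrib_left mult.commute
      vertex_degree_le_max_degree assms intro!: sum_mono mult_left_mono)

text \<open>Symmetry of the matrix merges the two cross terms of the expansion. The
  \<open>c\<^sup>2\<close> term is a multiple of the degree sum, so it is dropped, and the degree
  bound controls the cross term because \<open>x\<close> is nonnegative.\<close>

lemma quadratic_form_shift_ge:
  assumes G: "simple_graph G" and x: "\<And>w. x $ w \<ge> 0" and c: "c \<ge> 0"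
  shows "(x - c *\<^sub>R 1) \<bullet> (adjacency_matrix G *v (x - c *\<^sub>R 1))
    \<ge> x \<bullet> (adjacency_matrix G *v x) - 2 * c * (real (max_degree G) * (x \<bullet> 1))"
proof -
  let ?A = "adjacency_matrix G"
  have "(x - c *\<^sub>R 1) \<bullet> (?A *v (x - c *\<^sub>R 1)) =
      x \<bullet> (?A *v x) - 2 * c * (x \<bullet> (?A *v 1)) + c\<^sup>2 * (1 \<bullet> (?A *v 1))"
    using inner_adjacency_matrix_commute[OF G, of 1 x]
    by (simp add: matrix_vector_mult_diff_distrib matrix_vector_mult_scaleR inner_diff_left
        inner_diff_right power2_eq_square algebra_simps)
  moreover have "0 \<le> c\<^sup>2 * (1 \<bullet> (?A *v 1))"
    by (simp add: inner_vec_def adjacency_matrix_mult_one_nth sum_nonneg)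
  moreover have "2 * c * (x \<bullet> (?A *v 1)) \<le> 2 * c * (real (max_degree G) * (x \<bullet> 1))"
    using inner_adjacency_matrix_one_le[OF x, where G = G] c by (intro mult_left_mono) auto
  ultimately show ?thesis by linarith
qed

text \<open>The test vector is the difference of the basis vectors at \<open>u\<close> and
  \<open>v\<close>; the diagonal of the matrix vanishes, so only the entries for the pair
  contribute.\<close>

lemma beta_ge_pair:
  fixes u v :: "'v::finite"
  assumes G: "simple_graph G" and "u \<noteq> v"
  shows "beta G \<ge> (if G u v then -1 else 0)"
proof -
  let ?A = "adjacency_matrix G" and ?y = "axis u 1 - axis v 1 :: real ^ 'v"
  have "card {u, v} \<le> CARD('v)"
    by (intro card_mono) auto
  then have card: "CARD('v) \<ge> 2"
    using \<open>u \<noteq> v\<close> by simp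
  have "?y \<noteq> 0"
    using \<open>u \<noteq> v\<close> by (simp add: axis_eq_axis)
  moreover have "?y \<bullet> 1 = 0"
    by (simp add: inner_diff_left inner_axis')
  ultimately have "rayleigh_quotient ?A ?y \<le> beta G"
    by (rule beta_is_maximum(2)[OF card])
  moreover have axis: "axis a 1 \<bullet> (?A *v axis b 1) = (if G a b then 1 else 0)" for a b
    by (simp add: inner_axis' matrix_vector_mult_basis column_def adjacency_matrix_def)
  have "?y \<bullet> (?A *v ?y) = (if G u v then -2 else 0)"
    using G by (auto simp: inner_diff_left inner_diff_right matrix_vector_mult_diff_distrib axis
        simple_graph_def irreflp_def dest: sympD)
  moreover have "?y \<bullet> ?y = 2"
    using \<open>u \<noteq> v\<close> by (simp add: inner_diff_left inner_diff_right inner_axis_axis)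
  ultimately show ?thesis
    by (simp add: rayleigh_quotient_def split: if_splits)
qed

text \<open>\<open>x\<close> is the Perron eigenvector of the star with \<open>t\<close> leaves,
  whose eigenvalue is \<open>sqrt t\<close>; further edges of \<open>G\<close> only add nonnegative
  terms.\<close>

lemma star_vector:
  fixes G :: "'v::finite \<Rightarrow> 'v \<Rightarrow> bool"
  assumes G: "simple_graph G" and t: "t \<le> max_degree G"
  obtains x :: "real ^ 'v" where "\<And>w. x $ w \<ge> 0" "x \<bullet> x = 2 * real t"
    "x \<bullet> 1 = sqrt t * (sqrt t + 1)" "x \<bullet> (adjacency_matrix G *v x) \<ge> 2 * real t * sqrt t"
proof -
  obtain u where "card {v. G u v} = max_degree G"
    using max_degree_attained[of G] by (auto simp: vertex_degree_def)
  with t obtain T where T: "T \<subseteq> {v. G u v}" "card T = t"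
    by (metis obtain_subset_with_card_n)
  with G have u: "u \<notin> T" and sym: "\<And>v. v \<in> T \<Longrightarrow> G v u"
    by (auto simp: simple_graph_def irreflp_def dest: sympD)
  define x :: "real ^ 'v" where "x = (\<chi> w. if w = u then sqrt t else if w \<in> T then 1 else 0)"
  have nonneg: "x $ w \<ge> 0" for w
    by (simp add: x_def)
  have star_sum: "(\<Sum>w\<in>UNIV. x $ w * f w) = sqrt t * f u + sum f T" for f
  proof -
    have "(\<Sum>w\<in>UNIV. x $ w * f w) = (\<Sum>w\<in>insert u T. x $ w * f w)"
      by (rule sum.mono_neutral_right) (auto simp: x_def)
    also have "\<dots> = sqrt t * f u + (\<Sum>w\<in>T. x $ w * f w)"
      using u by (simp add: x_def)
    also have "(\<Sum>w\<in>T. x $ w * f w) = sum f T"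
      using u by (intro sum.cong) (auto simp: x_def)
    finally show ?thesis .
  qed
  have x_T: "(\<Sum>w\<in>T. x $ w) = t"
  proof -
    have "(\<Sum>w\<in>T. x $ w) = (\<Sum>w\<in>T. 1)"
      using u by (intro sum.cong) (auto simp: x_def)
    with T show ?thesis by simp
  qed
  have x_u: "x $ u = sqrt t"
    by (simp add: x_def)
  have xx: "x \<bullet> x = 2 * real t"
    using star_sum[of "\<lambda>w. x $ w"] by (simp add: inner_vec_def x_T x_u)
  have x1: "x \<bullet> 1 = sqrt t * (sqrt t + 1)"
    using star_sum[of "\<lambda>w. 1"] T by (simp add: inner_vec_def algebra_simps)
  \<comment> \<open>At the centre the leaves contribute \<open>t = sqrt t * sqrt t\<close>; at a
    leaf the centre contributes \<open>sqrt t\<close>; elsewhere the left side is 0.\<close>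
  have "sqrt t * x $ w \<le> (adjacency_matrix G *v x) $ w" for w
  proof -
    consider "w = u" | "w \<in> T" "w \<noteq> u" | "w \<notin> T" "w \<noteq> u" by blast
    then show ?thesis
    proof cases
      case 1
      have "sum (($) x) T \<le> (\<Sum>v | G u v. x $ v)"
        using T nonneg by (intro sum_mono2) auto
      with 1 show ?thesis by (simp add: adjacency_matrix_mult_nth x_T x_u)
    next
      case 2
      have "x $ u \<le> (\<Sum>v | G w v. x $ v)"
        using 2 sym nonneg by (intro member_le_sum) auto
      with 2 show ?thesis by (simp add: adjacency_matrix_mult_nth x_u) (simp add: x_def)
    next
      case 3
      then have "x $ w = 0" by (simp add: x_def)
      then show ?thesis by (simp add: adjacency_matrix_mult_nth sum_nonneg nonneg)
    qed
  qed
  then have "(\<Sum>w\<in>UNIV. x $ w * (sqrt t * x $ w)) \<le> x \<bullet> (adjacency_matrix G *v x)"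
    using nonneg by (auto simp: inner_vec_def intro!: sum_mono mult_left_mono)
  moreover have "(\<Sum>w\<in>UNIV. x $ w * (sqrt t * x $ w)) = sqrt t * (x \<bullet> x)"
    by (simp add: inner_vec_def sum_distrib_left mult.left_commute)
  ultimately have "x \<bullet> (adjacency_matrix G *v x) \<ge> 2 * real t * sqrt t"
    by (simp add: xx mult.commute)
  with nonneg xx x1 show ?thesis by (rule that)
qed

theorem lemma3p11:
  fixes G :: "'v::finite \<Rightarrow> 'v \<Rightarrow> bool" and n \<Delta> t :: nat
  assumes "simple_graph G"
    and "n = CARD('v)"
    and "\<Delta> = max_degree G"
    and "t \<ge> 1"
    and "t \<le> \<Delta>"
  shows "beta G \<ge> sqrt (real t) - real \<Delta> / real n * (sqrt (real t) + 1)\<^sup>2"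
proof -
  let ?A = "adjacency_matrix G" and ?R = "sqrt (real t) - real \<Delta> / real n * (sqrt (real t) + 1)\<^sup>2"
  note G = \<open>simple_graph G\<close>
  obtain u where deg_u: "card {v. G u v} = \<Delta>"
    using max_degree_attained[of G] \<open>\<Delta> = max_degree G\<close> by (auto simp: vertex_degree_def)
  with \<open>t \<ge> 1\<close> \<open>t \<le> \<Delta>\<close> have "{v. G u v} \<noteq> {}"
    by force
  then obtain v where "G u v" by blast
  with G have "u \<noteq> v"
    by (auto simp: simple_graph_def irreflp_def)
  have "card {u, v} \<le> CARD('v)"
    by (intro card_mono) auto
  then have n: "n \<ge> 2"
    using \<open>u \<noteq> v\<close> \<open>n = CARD('v)\<close> by simp
  show ?thesis
  proof (cases "?R > 0")
    case True
    obtain x where x: "\<And>w. x $ w \<ge> 0" "x \<bullet> x = 2 * real t" "x \<bullet> 1 = sqrt t * (sqrt t + 1)"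
      "x \<bullet> (?A *v x) \<ge> 2 * real t * sqrt t"
      using star_vector[OF G, of t] assms by metis
    \<comment> \<open>\<open>c\<close> is the mean entry of \<open>x\<close>, so \<open>y\<close> is
      the projection of \<open>x\<close> to the complement of the all ones vector.\<close>
    define c where "c = (x \<bullet> 1) / n"
    define y where "y = x - c *\<^sub>R 1"
    have c: "c \<ge> 0"
      by (simp add: c_def x(3))
    have one: "1 \<bullet> (1 :: real ^ 'v) = n"
      using assms by (simp add: inner_vec_def)
    have cn: "c * n = x \<bullet> 1"
      using n by (simp add: c_def)
    have y1: "y \<bullet> 1 = 0"
      by (simp add: y_def inner_diff_left one cn)
    have "y \<bullet> y = x \<bullet> x - c * (x \<bullet> 1)"
      using y1 by (simp add: y_def inner_diff_left inner_diff_right inner_commute)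
    then have yy: "y \<bullet> y \<le> 2 * real t"
      using c x(2,3) by simp
    \<comment> \<open>Here \<open>c * (x \<bullet> 1)\<close> equals
      \<open>t * (sqrt t + 1)\<^sup>2 / n\<close>.\<close>
    have "2 * real t * ?R = 2 * real t * sqrt t - 2 * c * (real \<Delta> * (x \<bullet> 1))"
      using n by (simp add: c_def x(3) power2_eq_square field_simps)
    also have "\<dots> \<le> y \<bullet> (?A *v y)"
      using quadratic_form_shift_ge[OF G x(1) c] x(4) unfolding y_def \<open>\<Delta> = max_degree G\<close> by linarith
    finally have yAy: "2 * real t * ?R \<le> y \<bullet> (?A *v y)" .
    have "0 < 2 * real t * ?R"
      using True \<open>t \<ge> 1\<close> by simp
    with yAy have "y \<noteq> 0" by auto
    \<comment> \<open>An upper bound on the norm helps only because \<open>?R\<close> is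
      positive.\<close>
    have "?R * (y \<bullet> y) \<le> ?R * (2 * real t)"
      using True yy by (intro mult_left_mono) auto
    with yAy \<open>y \<noteq> 0\<close> have "?R \<le> rayleigh_quotient ?A y"
      by (simp add: rayleigh_quotient_def pos_le_divide_eq mult.commute)
    also have "\<dots> \<le> beta G"
      using beta_is_maximum(2) n \<open>n = CARD('v)\<close> \<open>y \<noteq> 0\<close> y1 by blast
    finally show ?thesis .
  next
    case nonpos: False
    show ?thesis
    proof (cases "\<exists>w. w \<noteq> u \<and> \<not> G u w")
      case True
      then obtain w where w: "w \<noteq> u" "\<not> G u w" by blast
      then have "0 \<le> beta G"
        using beta_ge_pair[OF G, of u w] by simp
      with nonpos show ?thesis by linarith
    next
      case False
      \<comment> \<open>Only \<open>u\<close> is known to be adjacent to all other vertices; this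
        already fixes \<Delta>.\<close>
      with G have "{v. G u v} = UNIV - {u}"
        by (auto simp: simple_graph_def irreflp_def)
      then have "\<Delta> = n - 1"
        using deg_u assms(2) by (simp add: card_Diff_singleton)
      then have "1 / 2 \<le> real \<Delta> / real n"
        using n by (simp add: field_simps of_nat_diff)
      then have "1 / 2 * (sqrt t + 1)\<^sup>2 \<le> real \<Delta> / real n * (sqrt t + 1)\<^sup>2"
        by (rule mult_right_mono) simp
      \<comment> \<open>The \<open>sqrt t\<close> terms cancel, leaving \<open>?R\<close> at most
        \<open>-(t + 1) / 2\<close>, which is at most -1 since \<open>t \<ge> 1\<close>.\<close>
      moreover have "1 / 2 * (sqrt t + 1)\<^sup>2 = real t / 2 + sqrt t + 1 / 2"
        by (simp add: power2_eq_square field_simps)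
      ultimately have "?R \<le> -1"
        using \<open>t \<ge> 1\<close> by linarith
      then show ?thesis
        using beta_ge_pair[OF G \<open>u \<noteq> v\<close>] \<open>G u v\<close> by simp
    qed
  qed
qed

end
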